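(* Let $X,Y\in\widehat{\mathbb{Q}}(\sigma)$ be two distinct points, represented by irreducible fractions. Equip every point of $\widehat{\mathbb{Q}}(\sigma)$ with its standard horosphere. Then $\lambda_{XY}=l(X,Y)$.
   Context: Let $\sigma=e^{i\pi/3}=\frac{1+i\sqrt3}{2}$, $\mathbb{Z}[\sigma]$ the Eisenstein integers, $\mathbb{Q}(\sigma)$ its fraction field, $\widehat{\mathbb{Q}}(\sigma)=\mathbb{Q}(\sigma)\cup\{\infty\}$. A fraction $p/q$ ($p,q\in\mathbb{Z}[\sigma]$, not both zero, $p/0=\infty$) is irreducible if every common factor $k\in\mathbb{Z}[\sigma]$ of $p,q$ has $|k|=1$. Det-length: $l(p_1/q_1,p_2/q_2)=|p_1q_2-p_2q_1|$ for irreducible fractions. In the upper half-space model of $\mathbb{H}^3$ (boundary $\widehat{\mathbb{C}}$), let $T$ be the regular ideal tetrahedron with vertices $0,1,\sigma,\infty$, $H$ the group generated by reflections in its faces, and call $hT$, $h\in H$, fundamental tetrahedra (they tile $\mathbb{H}^3$, vertex set $\widehat{\mathbb{Q}}(\sigma)$). $\lambda$-length: for distinct $A,B\in\partial\mathbb{H}^3$ with horospheres $h_A,h_B$ centred at them, $\lambda_{AB}=e^{d/2}$, where $d$ is the signed distance between $h_A$ and $h_B$ along the geodesic $AB$ (negative, equal to minus the distance between the intersection points of $AB$ with $h_A,h_B$, when the horoballs overlap). Standard horospheres: at $0,1,\sigma$ the Euclidean spheres of radius $1/2$ tangent to $\mathbb{C}$ at these points, at $\infty$ the horizontal plane at height $1$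 (pairwise tangent, permuted by symmetries of $T$); transporting them by $PGL_2(\mathbb{Z}[\sigma])$ (acting by Möbius transformations, preserving the tiling, transitive on $\widehat{\mathbb{Q}}(\sigma)$) gives a well-defined standard horosphere at every point of $\widehat{\mathbb{Q}}(\sigma)$. *)

theory Defs
  imports "HOL-Analysis.Analysis"
begin

section \<open>Eisenstein integers and irreducible fractions\<close>

definition eis_sigma :: complex where
  "eis_sigma = cis (pi / 3)"

definition eis_ints :: "complex set" where
  "eis_ints = {of_int m + of_int n * eis_sigma | m n. True}"

definition eis_field :: "complex set" where
  "eis_field = {p / q | p q. p \<in> eis_ints \<and> q \<in> eis_ints \<and> q \<noteq> 0}"

text \<open>Divisibility inside the Eisenstein integers; the class-based \<open>dvd\<close> on
  \<^typ>\<open>complex\<close> is divisibility in a field.\<close>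

definition eis_dvd :: "complex \<Rightarrow> complex \<Rightarrow> bool" where
  "eis_dvd k p \<longleftrightarrow> (\<exists>u\<in>eis_ints. p = k * u)"

definition irreducible_fraction :: "complex \<Rightarrow> complex \<Rightarrow> bool" where
  "irreducible_fraction p q \<longleftrightarrow>
     p \<in> eis_ints \<and> q \<in> eis_ints \<and> (p \<noteq> 0 \<or> q \<noteq> 0) \<and>
     (\<forall>k\<in>eis_ints. eis_dvd k p \<and> eis_dvd k q \<longrightarrow> cmod k = 1)"

definition det_length :: "complex \<times> complex \<Rightarrow> complex \<times> complex \<Rightarrow> real" where
  "det_length = (\<lambda>(p1, q1) (p2, q2). cmod (p1 * q2 - p2 * q1))"

section \<open>The upper half-space model\<close>

text \<open>The ideal boundary is the Riemann sphere. A point of hyperbolic 3-space is a pair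
  \<open>(z, t)\<close> with \<open>t > 0\<close>.\<close>

datatype ideal_point = Fin complex | Infty

definition eis_field_ext :: "ideal_point set" where
  "eis_field_ext = insert Infty (Fin ` eis_field)"

definition fraction :: "complex \<Rightarrow> complex \<Rightarrow> ideal_point" where
  "fraction p q = (if q = 0 then Infty else Fin (p / q))"

definition hyp_dist :: "complex \<times> real \<Rightarrow> complex \<times> real \<Rightarrow> real" where
  "hyp_dist = (\<lambda>(z, t) (w, s). arcosh (1 + ((cmod (z - w))\<^sup>2 + (t - s)\<^sup>2) / (2 * t * s)))"

text \<open>The geodesic with two distinct given ideal endpoints: a vertical half-line, or the
  half-circle orthogonal to the boundary plane whose diameter joins the endpoints.\<close>

fun geodesic :: "ideal_point \<Rightarrow> ideal_point \<Rightarrow> (complex \<times> real) set" where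
  "geodesic (Fin a) (Fin b) =
     {(z, t). t > 0 \<and> (\<exists>s::real. z = a + of_real s * (b - a)) \<and>
        (cmod (z - (a + b) / 2))\<^sup>2 + t\<^sup>2 = (cmod (b - a) / 2)\<^sup>2}"
| "geodesic (Fin a) Infty = {(z, t). t > 0 \<and> z = a}"
| "geodesic Infty (Fin a) = {(z, t). t > 0 \<and> z = a}"
| "geodesic Infty Infty = {}"

text \<open>In both functions below the parameter is the Euclidean radius of the sphere for a finite
  centre, and the height of the horizontal plane for the centre \<open>\<infinity>\<close>; it is meant to be
  positive. Horoballs are open.\<close>

fun horosphere :: "ideal_point \<Rightarrow> real \<Rightarrow> (complex \<times> real) set" where
  "horosphere (Fin a) r = {(z, t). t > 0 \<and> (cmod (z - a))\<^sup>2 + (t - r)\<^sup>2 = r\<^sup>2}"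
| "horosphere Infty r = {(z, t). t = r}"

fun horoball :: "ideal_point \<Rightarrow> real \<Rightarrow> (complex \<times> real) set" where
  "horoball (Fin a) r = {(z, t). t > 0 \<and> (cmod (z - a))\<^sup>2 + (t - r)\<^sup>2 < r\<^sup>2}"
| "horoball Infty r = {(z, t). t > r}"

text \<open>The horoball bounded by a horosphere \<open>S\<close> centred at \<open>A\<close>. Such an \<open>S\<close> determines its
  parameter, so the union has just one member.\<close>

definition horoball_of :: "ideal_point \<Rightarrow> (complex \<times> real) set \<Rightarrow> (complex \<times> real) set" where
  "horoball_of A S = \<Union> {horoball A r | r. r > 0 \<and> S = horosphere A r}"

section \<open>Lambda lengths\<close>

definition signed_horo_dist ::
    "ideal_point \<Rightarrow> (complex \<times> real) set \<Rightarrow> ideal_point \<Rightarrow> (complex \<times> real) set \<Rightarrow> real" where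
  "signed_horo_dist A SA B SB =
     (let P = (THE P. P \<in> geodesic A B \<inter> SA);
          Q = (THE Q. Q \<in> geodesic A B \<inter> SB)
      in if horoball_of A SA \<inter> horoball_of B SB = {} then hyp_dist P Q else - hyp_dist P Q)"

definition lambda_length ::
    "ideal_point \<Rightarrow> (complex \<times> real) set \<Rightarrow> ideal_point \<Rightarrow> (complex \<times> real) set \<Rightarrow> real" where
  "lambda_length A SA B SB = exp (signed_horo_dist A SA B SB / 2)"

section \<open>Moebius action and standard horospheres\<close>

definition eis_GL2 :: "(complex^2^2) set" where
  "eis_GL2 = {M. (\<forall>i j. M $ i $ j \<in> eis_ints) \<and> (\<exists>u\<in>eis_ints. det M * u = 1)}"

fun moebius :: "complex^2^2 \<Rightarrow> ideal_point \<Rightarrow> ideal_point" where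
  "moebius M (Fin z) = fraction (M$1$1 * z + M$1$2) (M$2$1 * z + M$2$2)"
| "moebius M Infty = fraction (M$1$1) (M$2$1)"

text \<open>The Poincare extension of the Moebius transformation to the upper half-space, in the form
  valid for an invertible matrix of arbitrary determinant.\<close>

definition poincare_ext :: "complex^2^2 \<Rightarrow> complex \<times> real \<Rightarrow> complex \<times> real" where
  "poincare_ext M = (\<lambda>(z, t).
     let a = M$1$1; b = M$1$2; c = M$2$1; d = M$2$2;
         N = (cmod (c * z + d))\<^sup>2 + (cmod c)\<^sup>2 * t\<^sup>2
     in (((a * z + b) * cnj (c * z + d) + a * cnj c * of_real (t\<^sup>2)) / of_real N,
         cmod (det M) * t / N))"

definition base_vertices :: "ideal_point set" where
  "base_vertices = {Fin 0, Fin 1, Fin eis_sigma, Infty}"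

fun base_horosphere :: "ideal_point \<Rightarrow> (complex \<times> real) set" where
  "base_horosphere (Fin a) = horosphere (Fin a) (1 / 2)"
| "base_horosphere Infty = horosphere Infty 1"

text \<open>Scalar matrices act trivially on the boundary and on the half-space, so letting \<open>M\<close> range
  over \<^const>\<open>eis_GL2\<close> is the same as letting it range over the projective group. That the
  described horosphere is unique for each point of \<^const>\<open>eis_field_ext\<close> is not built into
  the definition.\<close>

definition std_horosphere :: "ideal_point \<Rightarrow> (complex \<times> real) set" where
  "std_horosphere X =
     (THE S. \<exists>M\<in>eis_GL2. \<exists>v\<in>base_vertices.
        moebius M v = X \<and> S = poincare_ext M ` base_horosphere v)"

end

theory Submission
  imports Defs
begin

text \<open>
  To a vector \<open>(p, q)\<close> attach the horosphere \<open>|p - q z|\<^sup>2 + |q|\<^sup>2 t\<^sup>2 = t\<close>. It is centred at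
  \<open>p / q\<close>, with Euclidean diameter \<open>1 / |q|\<^sup>2\<close> (or height \<open>|p|\<^sup>2\<close> if \<open>q = 0\<close>), and a matrix \<open>M\<close> with
  \<open>|det M| = 1\<close> carries the horosphere of \<open>v\<close> to the horosphere of \<open>M v\<close>. The base horospheres are
  those of \<open>(0, 1)\<close>, \<open>(1, 1)\<close>, \<open>(\<sigma>, 1)\<close>, \<open>(1, 0)\<close>. Since the Eisenstein integers are Euclidean,
  irreducible fractions are exactly the vectors satisfying a Bezout identity, and such a vector is
  determined by its quotient up to a unit, so the standard horosphere at \<open>p / q\<close> is the one
  attached to \<open>(p, q)\<close>. The \<open>\<lambda>\<close>-length of horospheres of radii \<open>r\<^sub>1\<close>, \<open>r\<^sub>2\<close> at \<open>a\<close>, \<open>b\<close> is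
  \<open>|a - b| / (2 sqrt (r\<^sub>1 r\<^sub>2))\<close>, which is the determinant.
\<close>

section \<open>Eisenstein integers\<close>

lemma eis_sigma_altdef: "eis_sigma = Complex (1 / 2) (sqrt 3 / 2)"
  by (simp add: eis_sigma_def complex_eq_iff cos_60 sin_60)

lemma eis_sigma_sq: "eis_sigma * eis_sigma = eis_sigma - 1"
  by (simp add: eis_sigma_altdef complex_eq_iff)

lemma cnj_eis_sigma: "cnj eis_sigma = 1 - eis_sigma"
  by (simp add: eis_sigma_altdef complex_eq_iff)

lemma eis_intsI: "of_int m + of_int n * eis_sigma \<in> eis_ints"
  by (auto simp: eis_ints_def)

lemma eis_intsE:
  assumes "x \<in> eis_ints"
  obtains m n where "x = of_int m + of_int n * eis_sigma"
  using assms by (auto simp: eis_ints_def)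

lemma zero_in_eis_ints [simp]: "0 \<in> eis_ints"
  using eis_intsI[of 0 0] by simp

lemma one_in_eis_ints [simp]: "1 \<in> eis_ints"
  using eis_intsI[of 1 0] by simp

lemma eis_sigma_in_eis_ints [simp]: "eis_sigma \<in> eis_ints"
  using eis_intsI[of 0 1] by simp

lemma eis_ints_add: "x \<in> eis_ints \<Longrightarrow> y \<in> eis_ints \<Longrightarrow> x + y \<in> eis_ints"
proof (elim eis_intsE)
  fix m n k l
  assume "x = of_int m + of_int n * eis_sigma" "y = of_int k + of_int l * eis_sigma"
  thus ?thesis using eis_intsI[of "m + k" "n + l"] by (simp add: algebra_simps)
qed

lemma eis_ints_minus: "x \<in> eis_ints \<Longrightarrow> - x \<in> eis_ints"
proof (elim eis_intsE)
  fix m n assume "x = of_int m + of_int n * eis_sigma"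
  thus ?thesis using eis_intsI[of "- m" "- n"] by (simp add: algebra_simps)
qed

lemma eis_ints_diff: "x \<in> eis_ints \<Longrightarrow> y \<in> eis_ints \<Longrightarrow> x - y \<in> eis_ints"
  using eis_ints_add[of x "- y"] eis_ints_minus[of y] by simp

lemma eis_ints_mult: "x \<in> eis_ints \<Longrightarrow> y \<in> eis_ints \<Longrightarrow> x * y \<in> eis_ints"
proof (elim eis_intsE)
  fix m n k l
  assume *: "x = of_int m + of_int n * eis_sigma" "y = of_int k + of_int l * eis_sigma"
  have "x * y = of_int (m * k) + of_int (m * l + n * k) * eis_sigma
                + of_int (n * l) * (eis_sigma * eis_sigma)"
    by (simp add: * algebra_simps)
  also have "\<dots> = of_int (m * k - n * l) + of_int (m * l + n * k + n * l) * eis_sigma"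
    unfolding eis_sigma_sq by (simp add: algebra_simps)
  finally show ?thesis using eis_intsI by metis
qed

lemma eis_ints_cnj: "x \<in> eis_ints \<Longrightarrow> cnj x \<in> eis_ints"
proof (elim eis_intsE)
  fix m n assume "x = of_int m + of_int n * eis_sigma"
  thus ?thesis using eis_intsI[of "m + n" "- n"] by (simp add: cnj_eis_sigma algebra_simps)
qed

lemmas eis_ints_closed = eis_ints_add eis_ints_minus eis_ints_diff eis_ints_mult

section \<open>The norm form and Euclidean division\<close>

lemma cmod_sq_sigma_coords:
  "(cmod (of_real x + of_real y * eis_sigma))\<^sup>2 = x\<^sup>2 + x * y + y\<^sup>2"
proof -
  have "(cmod (of_real x + of_real y * eis_sigma))\<^sup>2 = (x + y / 2)\<^sup>2 + (y * sqrt 3 / 2)\<^sup>2"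
    by (simp add: eis_sigma_altdef cmod_power2)
  also have "\<dots> = x\<^sup>2 + x * y + y\<^sup>2"
    by (simp add: power2_eq_square field_simps)
  finally show ?thesis .
qed

text \<open>Integrality of the norm form \<open>m^2 + m*n + n^2\<close>. It bounds nonzero elements
  away from 0 and makes descent on the norm possible.\<close>

lemma eis_norm_nat:
  assumes "x \<in> eis_ints"
  obtains k :: nat where "(cmod x)\<^sup>2 = real k"
proof -
  obtain m n where x: "x = of_int m + of_int n * eis_sigma"
    using assms by (rule eis_intsE)
  have *: "(cmod x)\<^sup>2 = of_int (m\<^sup>2 + m * n + n\<^sup>2)"
    using cmod_sq_sigma_coords[of "of_int m" "of_int n"] by (simp add: x)
  have "0 \<le> (of_int (m\<^sup>2 + m * n + n\<^sup>2) :: real)" using * by (metis zero_le_power2)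
  hence "m\<^sup>2 + m * n + n\<^sup>2 \<ge> 0" by linarith
  thus ?thesis using * that[of "nat (m\<^sup>2 + m * n + n\<^sup>2)"] by simp
qed

lemma eis_cmod_ge_1:
  assumes "x \<in> eis_ints" "x \<noteq> 0"
  shows "cmod x \<ge> 1"
proof -
  obtain k where k: "(cmod x)\<^sup>2 = real k" using assms(1) by (rule eis_norm_nat)
  have "k \<noteq> 0" using k assms(2) by (intro notI) simp
  hence "1 \<le> (cmod x)\<^sup>2" using k by simp
  thus ?thesis using power2_le_imp_le[of 1 "cmod x"] by simp
qed

lemma eis_unit_cmod:
  assumes "x \<in> eis_ints" "y \<in> eis_ints" "x * y = 1"
  shows "cmod x = 1"
proof -
  have "cmod x * cmod y = 1" by (metis assms(3) norm_mult norm_one)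
  moreover have "cmod x \<ge> 1" "cmod y \<ge> 1" using assms by (auto intro!: eis_cmod_ge_1)
  ultimately show ?thesis using mult_mono[of 1 "cmod x" 1 "cmod y"]
    by (smt (verit) mult_le_cancel_left1)
qed

text \<open>Euclidean property: rounding both coordinates in the basis \<open>1, eis_sigma\<close>
  leaves errors of at most 1/2, so the norm of the error is at most 3/4.\<close>

lemma eis_approx: "\<exists>k\<in>eis_ints. cmod (z - k) < 1"
proof -
  \<comment> \<open>\<open>x\<close> and \<open>y\<close> are the real coordinates of
    \<open>z\<close> in the basis \<open>1, eis_sigma\<close>.\<close>
  define y where "y = Im z * 2 / sqrt 3"
  define x where "x = Re z - y / 2"
  define u v where "u = x - of_int (round x)" and "v = y - of_int (round y)"
  define k where "k = of_int (round x) + of_int (round y) * eis_sigma"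
  have z: "z = of_real x + of_real y * eis_sigma"
    by (simp add: complex_eq_iff eis_sigma_altdef x_def y_def)
  have eq: "z - k = of_real u + of_real v * eis_sigma"
    by (simp add: z k_def u_def v_def algebra_simps)
  have uv: "\<bar>u\<bar> \<le> 1 / 2" "\<bar>v\<bar> \<le> 1 / 2"
    using of_int_round_abs_le[of x] of_int_round_abs_le[of y]
    by (simp_all add: u_def v_def abs_minus_commute)
  have "u\<^sup>2 \<le> (1/2)\<^sup>2" "v\<^sup>2 \<le> (1/2)\<^sup>2"
    using uv by (simp_all add: abs_le_square_iff[symmetric])
  moreover have "u * v \<le> (u\<^sup>2 + v\<^sup>2) / 2"
    using zero_le_power2[of "u - v"] by (simp add: power2_diff)
  ultimately have "u\<^sup>2 + u * v + v\<^sup>2 < 1" by (simp add: power_divide)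
  hence "(cmod (z - k))\<^sup>2 < 1\<^sup>2"
    unfolding eq cmod_sq_sigma_coords by simp
  hence "cmod (z - k) < 1" by (rule power2_less_imp_less) simp
  thus ?thesis using eis_intsI unfolding k_def by blast
qed

section \<open>Unimodular vectors\<close>

text \<open>The Bezout form of coprimality: invertible matrices transport it directly, and it
  completes a vector to a matrix of determinant 1.\<close>

definition eis_unimodular :: "complex \<Rightarrow> complex \<Rightarrow> bool" where
  "eis_unimodular p q \<longleftrightarrow> p \<in> eis_ints \<and> q \<in> eis_ints \<and>
     (\<exists>a\<in>eis_ints. \<exists>b\<in>eis_ints. a * p + b * q = 1)"

text \<open>The ideal \<open>I\<close> generated by \<open>p\<close> and \<open>q\<close> is
  principal: a nonzero element of least norm divides all others. As a common divisor of
  \<open>p\<close> and \<open>q\<close> it has modulus 1, so it can be scaled to 1.\<close>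

lemma irreducible_fraction_unimodular:
  assumes "irreducible_fraction p q"
  shows "eis_unimodular p q"
proof -
  have pq: "p \<in> eis_ints" "q \<in> eis_ints" "p \<noteq> 0 \<or> q \<noteq> 0"
    and irr: "\<And>k. k \<in> eis_ints \<Longrightarrow> eis_dvd k p \<Longrightarrow> eis_dvd k q \<Longrightarrow> cmod k = 1"
    using assms by (auto simp: irreducible_fraction_def)
  define I where "I = {a * p + b * q | a b. a \<in> eis_ints \<and> b \<in> eis_ints}"
  have I_eis: "x \<in> eis_ints" if "x \<in> I" for x
    using that pq by (auto simp: I_def intro!: eis_ints_closed)
  have I_diff: "x - k * y \<in> I" if xy: "x \<in> I" "y \<in> I" and k: "k \<in> eis_ints" for x y k
  proof -
    obtain a b where ab: "x = a * p + b * q" "a \<in> eis_ints" "b \<in> eis_ints"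
      using xy(1) by (auto simp: I_def)
    obtain c d where cd: "y = c * p + d * q" "c \<in> eis_ints" "d \<in> eis_ints"
      using xy(2) by (auto simp: I_def)
    have "x - k * y = (a - k * c) * p + (b - k * d) * q"
      by (simp add: ab cd algebra_simps)
    thus ?thesis unfolding I_def using ab cd k by (blast intro: eis_ints_closed)
  qed
  have pI: "p \<in> I" unfolding I_def
    by (rule CollectI, rule exI[of _ 1], rule exI[of _ 0]) simp
  have qI: "q \<in> I" unfolding I_def
    by (rule CollectI, rule exI[of _ 0], rule exI[of _ 1]) simp
  \<comment> \<open>The norm as a natural number, so that a least value exists; on
    \<open>eis_ints\<close> the floor changes nothing.\<close>
  define \<nu> :: "complex \<Rightarrow> nat" where "\<nu> x = nat \<lfloor>(cmod x)\<^sup>2\<rfloor>" for x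
  have \<nu>: "(cmod x)\<^sup>2 = real (\<nu> x)" if x: "x \<in> eis_ints" for x
  proof -
    obtain k where "(cmod x)\<^sup>2 = real k" using x by (rule eis_norm_nat)
    thus ?thesis by (simp add: \<nu>_def)
  qed
  obtain g0 where g0: "g0 \<in> I \<and> g0 \<noteq> 0" using pq(3) pI qI by blast
  obtain g where g: "g \<in> I" "g \<noteq> 0" and g_min: "\<And>y. y \<in> I \<Longrightarrow> y \<noteq> 0 \<Longrightarrow> \<nu> g \<le> \<nu> y"
    using ex_has_least_nat[of "\<lambda>x. x \<in> I \<and> x \<noteq> 0", OF g0, of \<nu>] by blast
  have g_dvd: "eis_dvd g x" if x: "x \<in> I" for x
  proof -
    \<comment> \<open>Division with remainder: the rounded quotient leaves a remainder of smaller
      norm in \<open>I\<close>, which minimality of \<open>g\<close> forces to be 0.\<close>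
    obtain k where k: "k \<in> eis_ints" "cmod (x / g - k) < 1" using eis_approx by blast
    have r: "x - k * g \<in> I" using x g k I_diff by blast
    have "x - k * g = (x / g - k) * g" using g by (simp add: field_simps)
    hence "cmod (x - k * g) = cmod (x / g - k) * cmod g" by (simp add: norm_mult)
    also have "\<dots> < 1 * cmod g" using g k by (intro mult_strict_right_mono) auto
    finally have "(cmod (x - k * g))\<^sup>2 < (cmod g)\<^sup>2" by (intro power_strict_mono) auto
    hence "\<nu> (x - k * g) < \<nu> g" using \<nu> I_eis r g by simp
    hence "x - k * g = 0" using g_min[OF r] by force
    thus ?thesis using k by (auto simp: eis_dvd_def mult.commute)
  qed
  have "cmod g = 1" using irr I_eis g g_dvd pI qI by blast
  \<comment> \<open>The conjugate of \<open>g\<close>, again an Eisenstein integer, serves as its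
    inverse.\<close>
  hence unit: "cnj g * g = 1"
    by (metis complex_norm_square mult.commute of_real_1 power_one)
  obtain a b where ab: "g = a * p + b * q" "a \<in> eis_ints" "b \<in> eis_ints"
    using g(1) by (auto simp: I_def)
  have "cnj g \<in> eis_ints" using I_eis g eis_ints_cnj by blast
  moreover have "(cnj g * a) * p + (cnj g * b) * q = 1"
    using unit unfolding ab(1) by (simp add: algebra_simps)
  ultimately show ?thesis
    unfolding eis_unimodular_def using pq ab eis_ints_mult by blast
qed

text \<open>The Bezout functional \<open>a * _ + b * _\<close> takes the value 1 on
  \<open>(p, q)\<close>, so its value on \<open>(p', q')\<close> must be the factor of
  proportionality.\<close>

lemma eis_unimodular_multiplier:
  assumes "eis_unimodular p q" "p' \<in> eis_ints" "q' \<in> eis_ints" "p * q' = q * p'"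
  obtains l where "l \<in> eis_ints" "p' = l * p" "q' = l * q"
proof -
  obtain a b where ab: "a \<in> eis_ints" "b \<in> eis_ints" "a * p + b * q = 1"
    using assms(1) by (auto simp: eis_unimodular_def)
  show ?thesis
  proof (rule that[of "a * p' + b * q'"])
    show "a * p' + b * q' \<in> eis_ints" using ab assms by (intro eis_ints_add eis_ints_mult)
    have "(a * p' + b * q') * p = p' * (a * p) + b * (p * q')" by (simp add: algebra_simps)
    also have "\<dots> = p' * (a * p + b * q)" unfolding assms(4) by (simp add: algebra_simps)
    finally show "p' = (a * p' + b * q') * p" by (simp add: ab(3))
    have "(a * p' + b * q') * q = a * (q * p') + q' * (b * q)" by (simp add: algebra_simps)
    also have "\<dots> = q' * (a * p + b * q)"
      unfolding assms(4)[symmetric] by (simp add: algebra_simps)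
    finally show "q' = (a * p' + b * q') * q" by (simp add: ab(3))
  qed
qed

text \<open>Each vector is an Eisenstein multiple of the other. The Bezout identity shows that the
  two factors have product 1, so they are units.\<close>

lemma eis_unimodular_proportional:
  assumes "eis_unimodular p q" "eis_unimodular p' q'" "p * q' = q * p'"
  obtains l where "cmod l = 1" "p' = l * p" "q' = l * q"
proof -
  have eis: "p \<in> eis_ints" "q \<in> eis_ints" "p' \<in> eis_ints" "q' \<in> eis_ints"
    using assms by (auto simp: eis_unimodular_def)
  obtain l where l: "l \<in> eis_ints" "p' = l * p" "q' = l * q"
    using eis_unimodular_multiplier[OF assms(1) eis(3,4) assms(3)] .
  have "p' * q = q' * p" using assms(3) by (simp add: mult.commute)
  then obtain k where k: "k \<in> eis_ints" "p = k * p'" "q = k * q'"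
    using eis_unimodular_multiplier[OF assms(2) eis(1,2)] by blast
  obtain a b where ab: "a * p + b * q = 1"
    using assms(1) by (auto simp: eis_unimodular_def)
  have "l * k = 1" using ab l(2,3) k(2,3) by algebra
  hence "cmod l = 1" using eis_unit_cmod l(1) k(1) by blast
  thus ?thesis using that l by blast
qed

lemma fraction_eq_imp_cross:
  assumes "fraction p q = fraction p' q'"
  shows "p * q' = q * p'"
  using assms by (auto simp: fraction_def field_simps split: if_splits)

section \<open>Horospheres attached to vectors\<close>

text \<open>Divided by the height \<open>t\<close>, this is the value at \<open>(p, q)\<close> of
  the positive definite Hermitian form of determinant 1 that represents the point
  \<open>(z, t)\<close>.\<close>

definition vec_form :: "complex \<Rightarrow> complex \<Rightarrow> complex \<times> real \<Rightarrow> real" where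
  "vec_form p q = (\<lambda>(z, t). (cmod (p - q * z))\<^sup>2 + (cmod q)\<^sup>2 * t\<^sup>2)"

definition vec_horosphere :: "complex \<Rightarrow> complex \<Rightarrow> (complex \<times> real) set" where
  "vec_horosphere p q = {P. snd P > 0 \<and> vec_form p q P = snd P}"

lemma vec_form_scale: "vec_form (l * p) (l * q) P = (cmod l)\<^sup>2 * vec_form p q P"
proof -
  have "l * p - l * q * z = l * (p - q * z)" for z by (simp add: algebra_simps)
  thus ?thesis
    by (cases P) (simp add: vec_form_def norm_mult power_mult_distrib distrib_left mult.assoc)
qed

text \<open>Divide by \<open>(cmod q)^2\<close> and complete the square in \<open>t\<close>.\<close>

lemma vec_horosphere_Fin:
  assumes "q \<noteq> 0"
  shows "vec_horosphere p q = horosphere (Fin (p / q)) (1 / (2 * (cmod q)\<^sup>2))"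
proof -
  have "vec_form p q (z, t) = t \<longleftrightarrow>
      (cmod (z - p / q))\<^sup>2 + (t - 1 / (2 * (cmod q)\<^sup>2))\<^sup>2 = (1 / (2 * (cmod q)\<^sup>2))\<^sup>2" for z t
  proof -
    have "p - q * z = - (q * (z - p / q))" using assms by (simp add: field_simps)
    hence "cmod (p - q * z) = cmod q * cmod (z - p / q)" by (simp only: norm_minus_cancel norm_mult)
    hence "vec_form p q (z, t) = (cmod q)\<^sup>2 * ((cmod (z - p / q))\<^sup>2 + t\<^sup>2)"
      by (simp add: vec_form_def power_mult_distrib algebra_simps)
    moreover have "m * (w + t\<^sup>2) = t \<longleftrightarrow> w + (t - 1 / (2 * m))\<^sup>2 = (1 / (2 * m))\<^sup>2"
      if "m \<noteq> 0" for m w :: real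
      using that by (simp add: power2_diff) (simp add: field_simps)
    ultimately show ?thesis using assms by simp
  qed
  thus ?thesis by (auto simp: vec_horosphere_def)
qed

lemma vec_horosphere_Infty:
  assumes "cmod p = 1"
  shows "vec_horosphere p 0 = horosphere Infty 1"
  using assms by (auto simp: vec_horosphere_def vec_form_def)

section \<open>Equivariance under the Poincare extension\<close>

text \<open>For \<open>T = t^2\<close> this is multiplicativity of the quaternion norm, for
  quaternions with complex components \<open>(u, q*t)\<close> and \<open>(v, c*t)\<close>.\<close>

lemma complex_product_identity:
  fixes u v q c :: complex and T :: real
  shows "(cmod (u * cnj v - q * cnj c * of_real T))\<^sup>2 + (cmod (c * u + q * v))\<^sup>2 * T
         = ((cmod u)\<^sup>2 + (cmod q)\<^sup>2 * T) * ((cmod v)\<^sup>2 + (cmod c)\<^sup>2 * T)"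
proof -
  \<comment> \<open>Over the complex numbers each squared modulus is a product with the conjugate,
    which leaves a polynomial identity.\<close>
  have "complex_of_real ((cmod (u * cnj v - q * cnj c * of_real T))\<^sup>2 + (cmod (c * u + q * v))\<^sup>2 * T)
         = of_real (((cmod u)\<^sup>2 + (cmod q)\<^sup>2 * T) * ((cmod v)\<^sup>2 + (cmod c)\<^sup>2 * T))"
    unfolding of_real_add of_real_mult complex_norm_square complex_cnj_add complex_cnj_diff
      complex_cnj_mult complex_cnj_cnj complex_cnj_complex_of_real
    by algebra
  thus ?thesis unfolding of_real_eq_iff .
qed

lemma snd_poincare_ext_pos:
  assumes "cmod (det M) = 1" "snd P > 0"
  shows "snd (poincare_ext M P) > 0"
proof -
  obtain z t where P: "P = (z, t)" by (cases P)
  let ?c = "M$2$1" and ?d = "M$2$2"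
  have "(cmod (?c * z + ?d))\<^sup>2 + (cmod ?c)\<^sup>2 * t\<^sup>2 > 0"
  proof (cases "?c = 0")
    case True
    hence "?d \<noteq> 0" using assms(1) by (auto simp: det_2)
    thus ?thesis using True by simp
  next
    case False
    thus ?thesis using assms(2) P by (intro add_nonneg_pos) auto
  qed
  thus ?thesis using assms P by (simp add: poincare_ext_def Let_def)
qed

text \<open>Invariance of the Hermitian form when point and vector move together. After clearing the
  denominator \<open>N\<close>, the determinant factors out with modulus 1, and the quaternion
  identity supplies a factor \<open>N\<close>.\<close>

lemma vec_form_poincare_ext:
  fixes M :: "complex^2^2"
  assumes "cmod (det M) = 1" "snd P > 0"
  shows "vec_form (M$1$1 * p + M$1$2 * q) (M$2$1 * p + M$2$2 * q) (poincare_ext M P)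
           / snd (poincare_ext M P) = vec_form p q P / snd P"
proof -
  obtain z t where P: "P = (z, t)" by (cases P)
  define a b c d where "a = M$1$1" and "b = M$1$2" and "c = M$2$1" and "d = M$2$2"
  define D where "D = det M"
  have D: "D = a * d - b * c" by (simp add: D_def det_2 a_def b_def c_def d_def)
  define N where "N = (cmod (c * z + d))\<^sup>2 + (cmod c)\<^sup>2 * t\<^sup>2"
  define W where "W = (a * z + b) * cnj (c * z + d) + a * cnj c * of_real (t\<^sup>2)"
  have ext: "poincare_ext M P = (W / of_real N, t / N)"
    using assms(1) by (simp add: poincare_ext_def P Let_def a_def b_def c_def d_def N_def W_def)
  have "snd (poincare_ext M P) > 0" using snd_poincare_ext_pos assms by blast
  hence N: "N > 0" and t: "t > 0" using ext assms(2) P by (auto simp: zero_less_divide_iff)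
  define x y where "x = a * p + b * q" and "y = c * p + d * q"
  have Nc: "of_real N = (c * z + d) * cnj (c * z + d) + c * cnj c * of_real (t\<^sup>2)"
    unfolding N_def by (simp only: of_real_add of_real_mult complex_norm_square)
  have "x * of_real N - y * W
        = D * ((p - q * z) * cnj (c * z + d) - q * cnj c * of_real (t\<^sup>2))"
    unfolding Nc W_def x_def y_def D by (simp add: algebra_simps)
  moreover have "y = c * (p - q * z) + q * (c * z + d)"
    by (simp add: y_def algebra_simps)
  moreover have "cmod D = 1" using assms(1) D_def by simp
  ultimately have eq: "(cmod (x * of_real N - y * W))\<^sup>2 + (cmod y)\<^sup>2 * t\<^sup>2 = vec_form p q P * N"
    using complex_product_identity[of "p - q * z" "c * z + d" q c "t\<^sup>2"]
    by (simp add: norm_mult vec_form_def P N_def)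
  have "x - y * (W / of_real N) = (x * of_real N - y * W) / of_real N"
    using N by (simp add: field_simps)
  hence "cmod (x - y * (W / of_real N)) = cmod (x * of_real N - y * W) / N"
    using N by (simp add: norm_divide)
  hence "vec_form x y (W / of_real N, t / N)
         = ((cmod (x * of_real N - y * W))\<^sup>2 + (cmod y)\<^sup>2 * t\<^sup>2) / N\<^sup>2"
    by (simp add: vec_form_def power_divide add_divide_distrib)
  \<comment> \<open>One factor of \<open>N^2\<close> cancels here; the other cancels against the new
    height \<open>t / N\<close>.\<close>
  hence "vec_form x y (poincare_ext M P) = vec_form p q P / N"
    unfolding eq ext using N by (simp add: power2_eq_square)
  thus ?thesis unfolding ext using N t
    by (simp add: x_def y_def a_def b_def c_def d_def P)
qed

text \<open>The vector \<open>(1, 0)\<close> recovers the height, and \<open>(x, 1)\<close> then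
  recovers the distance from \<open>x\<close> to \<open>z\<close>; taking \<open>x = z'\<close>
  makes that distance 0.\<close>

lemma vec_form_separates_points:
  assumes "snd P > 0" "snd P' > 0"
    and eq: "\<And>p q. vec_form p q P / snd P = vec_form p q P' / snd P'"
  shows "P = P'"
proof -
  obtain z t z' t' where P: "P = (z, t)" "P' = (z', t')" by (cases P, cases P')
  have t: "t' = t" using eq[of 1 0] by (simp add: vec_form_def P)
  hence "(cmod (x - z))\<^sup>2 = (cmod (x - z'))\<^sup>2" for x
    using eq[of x 1] assms(1) by (simp add: vec_form_def P)
  from this[of z'] show ?thesis using t by (simp add: P)
qed

lemma poincare_ext_surj:
  fixes M :: "complex^2^2"
  assumes M: "cmod (det M) = 1" and P: "snd P > 0"
  obtains Q where "snd Q > 0" "poincare_ext M Q = P"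
proof -
  \<comment> \<open>The adjugate: \<open>M\<close> after \<open>A\<close> multiplies vectors by the
    scalar \<open>det M\<close> of modulus 1, so all form values, and hence the point, are
    restored.\<close>
  define A :: "complex^2^2" where "A = vector [vector [M$2$2, - M$1$2], vector [- M$2$1, M$1$1]]"
  define Q where "Q = poincare_ext A P"
  have [simp]: "A$1$1 = M$2$2" "A$1$2 = - M$1$2" "A$2$1 = - M$2$1" "A$2$2 = M$1$1"
    by (simp_all add: A_def)
  have A: "cmod (det A) = 1" using M by (simp add: det_2 mult.commute)
  have Q: "snd Q > 0" unfolding Q_def using snd_poincare_ext_pos[OF A P] .
  have "poincare_ext M Q = P"
  proof (rule vec_form_separates_points)
    show "snd (poincare_ext M Q) > 0" using snd_poincare_ext_pos[OF M Q] .
    fix p q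
    have "vec_form (det M * p) (det M * q) (poincare_ext M Q) / snd (poincare_ext M Q)
          = vec_form p q P / snd P"
      using vec_form_poincare_ext[OF A P, of p q, folded Q_def]
        vec_form_poincare_ext[OF M Q, of "A$1$1 * p + A$1$2 * q" "A$2$1 * p + A$2$2 * q"]
      by (simp add: det_2 algebra_simps)
    thus "vec_form p q (poincare_ext M Q) / snd (poincare_ext M Q) = vec_form p q P / snd P"
      by (simp add: vec_form_scale M)
  qed (use P in simp)
  thus ?thesis using that Q by blast
qed

text \<open>A horosphere is the level set 1 of the normalized form, so invariance maps level set
  into level set, and surjectivity makes the image all of it.\<close>

lemma poincare_ext_vec_horosphere:
  fixes M :: "complex^2^2"
  assumes M: "cmod (det M) = 1"
  shows "poincare_ext M ` vec_horosphere p q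
         = vec_horosphere (M$1$1 * p + M$1$2 * q) (M$2$1 * p + M$2$2 * q)"
    (is "?L = vec_horosphere ?p ?q")
proof -
  have iff: "poincare_ext M P \<in> vec_horosphere ?p ?q \<longleftrightarrow> P \<in> vec_horosphere p q"
    if "snd P > 0" for P
    using vec_form_poincare_ext[OF M that, of p q] snd_poincare_ext_pos[OF M that] that
    unfolding vec_horosphere_def by (auto simp: field_simps)
  show ?thesis
  proof (intro equalityI subsetI)
    fix P assume "P \<in> ?L"
    thus "P \<in> vec_horosphere ?p ?q"
      using iff by (auto simp: vec_horosphere_def)
  next
    fix P assume P: "P \<in> vec_horosphere ?p ?q"
    then obtain Q where "snd Q > 0" "poincare_ext M Q = P"
      using poincare_ext_surj[OF M, of P] by (auto simp: vec_horosphere_def)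
    thus "P \<in> ?L" using iff P by blast
  qed
qed

section \<open>Standard horospheres\<close>

text \<open>Homogeneous coordinates \<open>(z, 1)\<close> and \<open>(1, 0)\<close> turn the Moebius
  action into a linear one, so finite and infinite vertices are treated alike.\<close>

lemma base_vertex_vector:
  assumes "v \<in> base_vertices"
  obtains x y where "eis_unimodular x y" "base_horosphere v = vec_horosphere x y"
    "\<And>M. moebius M v = fraction (M$1$1 * x + M$1$2 * y) (M$2$1 * x + M$2$2 * y)"
proof (cases v)
  case (Fin z)
  hence "z \<in> {0, 1, eis_sigma}" using assms by (auto simp: base_vertices_def)
  hence "z \<in> eis_ints" by auto
  hence "eis_unimodular z 1"
    unfolding eis_unimodular_def by (metis add_0 mult_1 mult_zero_left one_in_eis_ints zero_in_eis_ints)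
  thus ?thesis using that[of z 1] Fin vec_horosphere_Fin[of 1 z] by simp
next
  case Infty
  have "eis_unimodular 1 0"
    unfolding eis_unimodular_def by (metis add.right_neutral mult_1 mult_zero_left one_in_eis_ints zero_in_eis_ints)
  thus ?thesis using that[of 1 0] Infty vec_horosphere_Infty[of 1] by simp
qed

lemma eis_GL2_cmod_det:
  assumes "M \<in> eis_GL2"
  shows "cmod (det M) = 1"
proof -
  obtain u where "u \<in> eis_ints" "det M * u = 1" using assms by (auto simp: eis_GL2_def)
  moreover have "det M \<in> eis_ints"
    using assms by (auto simp: eis_GL2_def det_2 intro!: eis_ints_closed)
  ultimately show ?thesis using eis_unit_cmod by blast
qed

lemma eis_GL2_unimodular:
  assumes M: "M \<in> eis_GL2" and xy: "eis_unimodular x y"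
  shows "eis_unimodular (M$1$1 * x + M$1$2 * y) (M$2$1 * x + M$2$2 * y)"
proof -
  obtain u where u: "u \<in> eis_ints" "det M * u = 1" using M by (auto simp: eis_GL2_def)
  have ent: "M$i$j \<in> eis_ints" for i j using M by (auto simp: eis_GL2_def)
  obtain a b where ab: "a \<in> eis_ints" "b \<in> eis_ints" "a * x + b * y = 1"
    and xy': "x \<in> eis_ints" "y \<in> eis_ints"
    using xy by (auto simp: eis_unimodular_def)
  \<comment> \<open>The Bezout row \<open>(a, b)\<close> times the inverse of \<open>M\<close>,
    where \<open>u\<close> inverts the determinant.\<close>
  let ?a = "u * (a * M$2$2 - b * M$2$1)" and ?b = "u * (b * M$1$1 - a * M$1$2)"
  have "?a * (M$1$1 * x + M$1$2 * y) + ?b * (M$2$1 * x + M$2$2 * y)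
        = (det M * u) * (a * x + b * y)"
    by (simp add: det_2 algebra_simps)
  hence "?a * (M$1$1 * x + M$1$2 * y) + ?b * (M$2$1 * x + M$2$2 * y) = 1"
    using u ab by simp
  moreover have "?a \<in> eis_ints" "?b \<in> eis_ints"
    using u ent ab by (auto intro!: eis_ints_closed)
  moreover have "M$1$1 * x + M$1$2 * y \<in> eis_ints" "M$2$1 * x + M$2$2 * y \<in> eis_ints"
    using ent xy' by (auto intro!: eis_ints_closed)
  ultimately show ?thesis unfolding eis_unimodular_def by blast
qed

text \<open>Unimodular vectors of the same point differ by a factor of modulus 1, which the form
  does not see; this makes standard horospheres well defined.\<close>

lemma vec_horosphere_cong:
  assumes "eis_unimodular p q" "eis_unimodular p' q'" "fraction p q = fraction p' q'"
  shows "vec_horosphere p' q' = vec_horosphere p q"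
proof -
  obtain l where "cmod l = 1" "p' = l * p" "q' = l * q"
    using eis_unimodular_proportional[OF assms(1,2) fraction_eq_imp_cross[OF assms(3)]] .
  thus ?thesis by (simp add: vec_horosphere_def vec_form_scale)
qed

lemma std_horosphere_fraction:
  assumes pq: "eis_unimodular p q"
  shows "std_horosphere (fraction p q) = vec_horosphere p q"
  unfolding std_horosphere_def
proof (rule the_equality)
  obtain a b where ab: "a \<in> eis_ints" "b \<in> eis_ints" "a * p + b * q = 1"
    and pq': "p \<in> eis_ints" "q \<in> eis_ints"
    using pq by (auto simp: eis_unimodular_def)
  \<comment> \<open>Existence: the Bezout coefficients complete the column \<open>(p, q)\<close> to
    a matrix of determinant 1, which sends \<open>Infty\<close> to
    \<open>fraction p q\<close>.\<close>
  define M :: "complex^2^2" where "M = vector [vector [p, - b], vector [q, a]]"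
  have ent [simp]: "M$1$1 = p" "M$1$2 = - b" "M$2$1 = q" "M$2$2 = a" by (simp_all add: M_def)
  have det: "det M = 1" using ab by (simp add: det_2 mult.commute)
  have "\<forall>i j. M$i$j \<in> eis_ints"
    using pq' ab eis_ints_minus by (simp add: forall_2)
  moreover have "\<exists>u\<in>eis_ints. det M * u = 1"
    unfolding det by (rule bexI[of _ 1]) auto
  ultimately have M: "M \<in> eis_GL2" by (simp add: eis_GL2_def)
  have "vec_horosphere p q = poincare_ext M ` base_horosphere Infty"
    using poincare_ext_vec_horosphere[of M 1 0] det vec_horosphere_Infty[of 1] by simp
  moreover have "moebius M Infty = fraction p q" by simp
  moreover have "Infty \<in> base_vertices" by (simp add: base_vertices_def)
  ultimately show "\<exists>M\<in>eis_GL2. \<exists>v\<in>base_vertices. moebius M v = fraction p q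
      \<and> vec_horosphere p q = poincare_ext M ` base_horosphere v"
    using M by blast
next
  fix S assume "\<exists>M\<in>eis_GL2. \<exists>v\<in>base_vertices. moebius M v = fraction p q
      \<and> S = poincare_ext M ` base_horosphere v"
  then obtain M v where M: "M \<in> eis_GL2" and v: "v \<in> base_vertices"
    and Mv: "moebius M v = fraction p q" and S: "S = poincare_ext M ` base_horosphere v"
    by blast
  obtain x y where xy: "eis_unimodular x y" "base_horosphere v = vec_horosphere x y"
    "moebius M v = fraction (M$1$1 * x + M$1$2 * y) (M$2$1 * x + M$2$2 * y)"
    using base_vertex_vector[OF v] by metis
  show "S = vec_horosphere p q"
    unfolding S xy(2) poincare_ext_vec_horosphere[OF eis_GL2_cmod_det[OF M]]
    using vec_horosphere_cong[OF pq eis_GL2_unimodular[OF M xy(1)]] Mv xy(3) by simp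
qed

section \<open>Lambda lengths of horospheres\<close>

text \<open>The radius can be read off from a point: the top \<open>(a, 2 * r)\<close> for a finite
  centre, any point of the plane for \<open>Infty\<close>.\<close>

lemma horoball_of_horosphere:
  assumes "r > 0"
  shows "horoball_of A (horosphere A r) = horoball A r"
proof -
  have "r' = r" if r': "r' > 0" "horosphere A r = horosphere A r'" for r'
  proof (cases A)
    case (Fin a)
    have "(a, 2 * r) \<in> horosphere A r" using assms Fin by (simp add: power2_eq_square)
    hence "(a, 2 * r) \<in> horosphere A r'" using r'(2) by simp
    hence "(2 * r - r')\<^sup>2 = r'\<^sup>2" using Fin by simp
    thus ?thesis using assms r'(1) by (auto simp: power2_eq_iff)
  next
    case Infty
    have "(0, r) \<in> horosphere A r" using Infty by simp
    hence "(0, r) \<in> horosphere A r'" by (simp only: r'(2))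
    thus ?thesis using Infty by simp
  qed
  hence "{horoball A r' | r'. r' > 0 \<and> horosphere A r = horosphere A r'} = {horoball A r}"
    using assms by blast
  thus ?thesis by (simp add: horoball_of_def)
qed

text \<open>The argument equals \<open>(y/x + x/y) / 2\<close>, the hyperbolic cosine of
  \<open>ln (y/x)\<close>.\<close>

lemma arcosh_ratio:
  fixes x y :: real
  assumes "x > 0" "y > 0"
  shows "arcosh (1 + (x - y)\<^sup>2 / (2 * x * y)) = \<bar>ln (y / x)\<bar>"
proof -
  have "1 + (x - y)\<^sup>2 / (2 * x * y) = (y / x + inverse (y / x)) / 2"
    using assms by (simp add: field_simps power2_eq_square)
  also have "\<dots> = cosh (ln (y / x))" using assms by (subst cosh_ln_real) auto
  also have "\<dots> = cosh \<bar>ln (y / x)\<bar>" by simp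
  finally have eq: "1 + (x - y)\<^sup>2 / (2 * x * y) = cosh \<bar>ln (y / x)\<bar>" .
  show ?thesis unfolding eq by (rule arcosh_cosh_real) simp
qed

text \<open>\<open>x\<close> and \<open>y\<close> locate \<open>P\<close> and \<open>Q\<close> by a
  multiplicative parameter running from \<open>A\<close> to \<open>B\<close>. The horoballs are
  disjoint exactly when the points come in this order, so the sign convention turns
  \<open>\<bar>ln (y/x)\<bar>\<close> into \<open>ln (y/x)\<close>.\<close>

lemma lambda_length_eq_sqrt_ratio:
  assumes AB: "geodesic A B \<inter> SA = {P}" "geodesic A B \<inter> SB = {Q}"
    and xy: "x > 0" "y > 0" and dist: "hyp_dist P Q = arcosh (1 + (x - y)\<^sup>2 / (2 * x * y))"
    and disj: "horoball_of A SA \<inter> horoball_of B SB = {} \<longleftrightarrow> x \<le> y"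
  shows "lambda_length A SA B SB = sqrt (y / x)"
proof -
  have "(THE P. P \<in> geodesic A B \<inter> SA) = P" "(THE Q. Q \<in> geodesic A B \<inter> SB) = Q"
    unfolding AB by auto
  moreover have "\<bar>ln (y / x)\<bar> = (if x \<le> y then ln (y / x) else - ln (y / x))"
    using xy by (simp add: abs_if)
  ultimately have "signed_horo_dist A SA B SB = ln (y / x)"
    using dist disj arcosh_ratio[OF xy] by (simp add: signed_horo_dist_def)
  hence "lambda_length A SA B SB = exp (ln (y / x) / 2)" by (simp add: lambda_length_def)
  also have "\<dots> = exp (ln (sqrt (y / x)))" using xy by (simp add: ln_sqrt)
  also have "\<dots> = sqrt (y / x)" using xy by simp
  finally show ?thesis .
qed

section \<open>One centre at infinity: height is the parameter\<close>

lemma lambda_length_Fin_Infty: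
  assumes r: "r > 0" and h: "h > 0"
  shows "lambda_length (Fin a) (horosphere (Fin a) r) Infty (horosphere Infty h) = sqrt (h / (2 * r))"
proof (rule lambda_length_eq_sqrt_ratio)
  show "geodesic (Fin a) Infty \<inter> horosphere (Fin a) r = {(a, 2 * r)}"
    using r by (auto simp: power2_eq_iff)
  show "geodesic (Fin a) Infty \<inter> horosphere Infty h = {(a, h)}" using h by auto
  show "hyp_dist (a, 2 * r) (a, h) = arcosh (1 + (2 * r - h)\<^sup>2 / (2 * (2 * r) * h))"
    by (simp add: hyp_dist_def)
  have "horoball (Fin a) r \<inter> horoball Infty h = {} \<longleftrightarrow> 2 * r \<le> h"
  proof
    assume disj: "horoball (Fin a) r \<inter> horoball Infty h = {}"
    show "2 * r \<le> h"
    proof (rule ccontr)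
      assume "\<not> 2 * r \<le> h"
      hence "h < 2 * r" by simp
      \<comment> \<open>A height strictly between the plane and the top of the sphere gives a common
        point above \<open>a\<close>.\<close>
      define t where "t = (h + 2 * r) / 2"
      have "h < t" "t < 2 * r" using \<open>h < 2 * r\<close> by (auto simp: t_def)
      hence "\<bar>t - r\<bar> < \<bar>r\<bar>" using h by linarith
      hence "(t - r)\<^sup>2 < r\<^sup>2" using abs_le_square_iff[of r "t - r"] by linarith
      hence "(a, t) \<in> horoball (Fin a) r \<inter> horoball Infty h" using \<open>h < t\<close> h by simp
      thus False using disj by blast
    qed
  next
    assume le: "2 * r \<le> h"
    have False if "(z, t) \<in> horoball (Fin a) r \<inter> horoball Infty h" for z t
    proof -
      have ball: "(cmod (z - a))\<^sup>2 + (t - r)\<^sup>2 < r\<^sup>2" "h < t" using that by simp_all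
      have "(t - r)\<^sup>2 < r\<^sup>2" using ball(1) zero_le_power2[of "cmod (z - a)"] by linarith
      hence "t - r < r" using r by (rule power2_less_imp_less[OF _ less_imp_le])
      thus False using ball(2) le by simp
    qed
    thus "horoball (Fin a) r \<inter> horoball Infty h = {}"
      by (intro equals0I) (simp only: split_paired_all)
  qed
  thus "horoball_of (Fin a) (horosphere (Fin a) r) \<inter> horoball_of Infty (horosphere Infty h) = {}
        \<longleftrightarrow> 2 * r \<le> h"
    unfolding horoball_of_horosphere[OF r] horoball_of_horosphere[OF h] .
qed (simp_all add: r h)

lemma hyp_dist_commute: "hyp_dist P Q = hyp_dist Q P"
  by (cases P; cases Q)
    (simp add: hyp_dist_def norm_minus_commute power2_commute mult.commute mult.left_commute)

lemma lambda_length_Infty_Fin: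
  "lambda_length Infty S (Fin a) S' = lambda_length (Fin a) S' Infty S"
  by (simp add: lambda_length_def signed_horo_dist_def Let_def hyp_dist_commute Int_commute)

section \<open>Two finite centres\<close>

text \<open>The Euclidean centres are \<open>(a, r)\<close> and \<open>(b, s)\<close>; tangency
  means \<open>(cmod (b - a))^2 + (r - s)^2 = (r + s)^2\<close>, that is
  \<open>(cmod (b - a))^2 = 4*r*s\<close>.\<close>

lemma horoballs_disjoint_iff:
  assumes r: "r > 0" and s: "s > 0"
  shows "horoball (Fin a) r \<inter> horoball (Fin b) s = {} \<longleftrightarrow> 4 * r * s \<le> (cmod (b - a))\<^sup>2"
proof
  assume disj: "horoball (Fin a) r \<inter> horoball (Fin b) s = {}"
  show "4 * r * s \<le> (cmod (b - a))\<^sup>2"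
  proof (rule ccontr)
    assume "\<not> 4 * r * s \<le> (cmod (b - a))\<^sup>2"
    hence less: "(cmod (b - a))\<^sup>2 + (r - s)\<^sup>2 < (r + s)\<^sup>2"
      by (simp add: power2_eq_square algebra_simps)
    \<comment> \<open>the point dividing the segment between the Euclidean centres in the ratio of the radii\<close>
    define z where "z = a + of_real (r / (r + s)) * (b - a)"
    define t where "t = 2 * r * s / (r + s)"
    have za: "z - a = of_real (r / (r + s)) * (b - a)" by (simp add: z_def)
    have "of_real (r / (r + s)) + of_real (s / (r + s)) = (1 :: complex)"
      using r s by (simp add: add_divide_distrib[symmetric] flip: of_real_add)
    hence zb: "z - b = of_real (s / (r + s)) * (a - b)"
      unfolding z_def by algebra
    \<comment> \<open>The offset from either centre is the fraction \<open>\<rho> / (r + s)\<close>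
      of the offset between the centres, whose length is less than \<open>r + s\<close>.\<close>
    have *: "(cmod w)\<^sup>2 + (t - \<rho>)\<^sup>2 < \<rho>\<^sup>2"
      if "cmod w = \<rho> / (r + s) * cmod (b - a)" "\<bar>t - \<rho>\<bar> = \<rho> / (r + s) * \<bar>r - s\<bar>" "\<rho> > 0" for w \<rho>
    proof -
      have "(cmod w)\<^sup>2 + (t - \<rho>)\<^sup>2 = (\<rho> / (r + s))\<^sup>2 * ((cmod (b - a))\<^sup>2 + (r - s)\<^sup>2)"
        using that(1,2) power2_abs[of "t - \<rho>"]
        by (metis distrib_left power2_abs power_mult_distrib)
      also have "\<dots> < (\<rho> / (r + s))\<^sup>2 * (r + s)\<^sup>2"
        using less that(3) r s by (intro mult_strict_left_mono) auto
      also have "\<dots> = \<rho>\<^sup>2" using r s by (simp add: power_divide)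
      finally show ?thesis .
    qed
    have "t - r = r / (r + s) * (s - r)" "t - s = s / (r + s) * (r - s)"
      using r s by (simp_all add: t_def field_simps)
    hence "\<bar>t - r\<bar> = r / (r + s) * \<bar>r - s\<bar>" "\<bar>t - s\<bar> = s / (r + s) * \<bar>r - s\<bar>"
      using r s by (simp_all only: abs_mult abs_minus_commute) (simp_all add: abs_of_pos)
    moreover have "cmod (z - a) = r / (r + s) * cmod (b - a)" "cmod (z - b) = s / (r + s) * cmod (b - a)"
      unfolding za zb using r s by (simp_all add: norm_mult norm_divide norm_minus_commute del: of_real_divide)
    ultimately have "(cmod (z - a))\<^sup>2 + (t - r)\<^sup>2 < r\<^sup>2" "(cmod (z - b))\<^sup>2 + (t - s)\<^sup>2 < s\<^sup>2"
      using * r s by blast+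
    moreover have "t > 0" using r s by (simp add: t_def)
    ultimately have "(z, t) \<in> horoball (Fin a) r \<inter> horoball (Fin b) s" by simp
    thus False using disj by blast
  qed
next
  assume le: "4 * r * s \<le> (cmod (b - a))\<^sup>2"
  have False if t: "t > 0" and za: "(cmod (z - a))\<^sup>2 + (t - r)\<^sup>2 < r\<^sup>2"
    and zb: "(cmod (z - b))\<^sup>2 + (t - s)\<^sup>2 < s\<^sup>2" for z t
  proof -
    define u v where "u = cmod (z - a)" and "v = cmod (z - b)"
    have "u\<^sup>2 + t\<^sup>2 < 2 * r * t" "v\<^sup>2 + t\<^sup>2 < 2 * s * t"
      using za zb by (simp_all add: u_def v_def power2_eq_square algebra_simps)
    hence "(u\<^sup>2 + t\<^sup>2) * (v\<^sup>2 + t\<^sup>2) < (2 * r * t) * (2 * s * t)"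
      using t r s by (intro mult_strict_mono) (auto intro: add_nonneg_nonneg)
    \<comment> \<open>The two-square identity isolates \<open>u + v\<close>, which the triangle
      inequality bounds below by \<open>cmod (b - a)\<close>.\<close>
    moreover have "(u\<^sup>2 + t\<^sup>2) * (v\<^sup>2 + t\<^sup>2) = t\<^sup>2 * (u + v)\<^sup>2 + (u * v - t\<^sup>2)\<^sup>2"
      by (simp add: power2_eq_square algebra_simps)
    ultimately have "t\<^sup>2 * (u + v)\<^sup>2 < t\<^sup>2 * (4 * r * s)"
      using zero_le_power2[of "u * v - t\<^sup>2"] by (simp add: power2_eq_square algebra_simps)
    hence "(u + v)\<^sup>2 < 4 * r * s" using t by simp
    moreover have "cmod (b - a) \<le> u + v"
      unfolding u_def v_def using norm_triangle_ineq4[of "z - a" "z - b"] by simp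
    hence "(cmod (b - a))\<^sup>2 \<le> (u + v)\<^sup>2" by (intro power_mono) auto
    ultimately show False using le by linarith
  qed
  thus "horoball (Fin a) r \<inter> horoball (Fin b) s = {}" by auto
qed

text \<open>A multiplicative arc-length parameter on the geodesic from \<open>a\<close> to \<open>b\<close>: the image of
  \<open>(0, x)\<close> under a Moebius transformation taking \<open>0, \<infinity>\<close> to \<open>a, b\<close>.\<close>

definition geodesic_point :: "complex \<Rightarrow> complex \<Rightarrow> real \<Rightarrow> complex \<times> real" where
  "geodesic_point a b x =
     (a + of_real (x\<^sup>2 / (1 + x\<^sup>2)) * (b - a), cmod (b - a) * x / (1 + x\<^sup>2))"

lemma hyp_dist_geodesic_point:
  assumes "a \<noteq> b" "x > 0" "y > 0"
  shows "hyp_dist (geodesic_point a b x) (geodesic_point a b y) = arcosh (1 + (x - y)\<^sup>2 / (2 * x * y))"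
proof -
  define D where "D = cmod (b - a)"
  have D: "D > 0" using assms by (simp add: D_def)
  define X Y where "X = 1 + x\<^sup>2" and "Y = 1 + y\<^sup>2"
  have XY: "X > 0" "Y > 0" by (simp_all add: X_def Y_def add_pos_nonneg)
  have diff: "a + of_real (x\<^sup>2 / X) * (b - a) - (a + of_real (y\<^sup>2 / Y) * (b - a))
        = of_real (x\<^sup>2 / X - y\<^sup>2 / Y) * (b - a)"
    by (simp add: algebra_simps)
  have "x\<^sup>2 / X - y\<^sup>2 / Y = (x\<^sup>2 * Y - y\<^sup>2 * X) / (X * Y)"
    using XY by (simp add: field_simps)
  also have "x\<^sup>2 * Y - y\<^sup>2 * X = (x - y) * (x + y)"
    by (simp add: X_def Y_def algebra_simps power2_eq_square)
  finally have d1: "x\<^sup>2 / X - y\<^sup>2 / Y = (x - y) * (x + y) / (X * Y)" .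
  have "D * x / X - D * y / Y = D * (x * Y - y * X) / (X * Y)"
    using XY by (simp add: field_simps)
  also have "x * Y - y * X = (x - y) * (1 - x * y)"
    by (simp add: X_def Y_def algebra_simps power2_eq_square)
  finally have d2: "D * x / X - D * y / Y = D * ((x - y) * (1 - x * y)) / (X * Y)" .
  \<comment> \<open>A two-square identity that cancels one factor \<open>X * Y\<close> of the
    squared Euclidean distance; the product of the heights cancels the other.\<close>
  have XY_eq: "(x + y)\<^sup>2 + (1 - x * y)\<^sup>2 = X * Y"
    by (simp add: X_def Y_def algebra_simps power2_eq_square)
  have "(\<bar>x\<^sup>2 / X - y\<^sup>2 / Y\<bar> * D)\<^sup>2 + (D * x / X - D * y / Y)\<^sup>2
        = (D * (x - y))\<^sup>2 * ((x + y)\<^sup>2 + (1 - x * y)\<^sup>2) / (X * Y)\<^sup>2"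
    unfolding d1 d2 power_mult_distrib power2_abs power_divide
    by (simp add: algebra_simps add_divide_distrib)
  also have "\<dots> = (D * (x - y))\<^sup>2 / (X * Y)"
    unfolding XY_eq using XY by (simp add: power2_eq_square)
  finally have "((\<bar>x\<^sup>2 / X - y\<^sup>2 / Y\<bar> * D)\<^sup>2 + (D * x / X - D * y / Y)\<^sup>2) / (2 * (D * x / X) * (D * y / Y))
        = (x - y)\<^sup>2 / (2 * x * y)"
    using D XY assms by (simp add: field_simps power2_eq_square)
  thus ?thesis
    unfolding hyp_dist_def geodesic_point_def prod.case X_def[symmetric] Y_def[symmetric]
      diff norm_mult norm_of_real D_def[symmetric] by simp
qed

text \<open>With \<open>s\<close> the affine position of the foot on the diameter, the circle
  equation is the altitude rule: the squared height is the product of the two segments of the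
  diameter.\<close>

lemma geodesic_Fin_iff:
  assumes "a \<noteq> b"
  shows "(z, t) \<in> geodesic (Fin a) (Fin b) \<longleftrightarrow> t > 0 \<and>
    (\<exists>s. z = a + of_real s * (b - a) \<and> t\<^sup>2 = s * (1 - s) * (cmod (b - a))\<^sup>2)"
proof -
  have "(cmod (a + of_real s * (b - a) - (a + b) / 2))\<^sup>2 + t\<^sup>2 = (cmod (b - a) / 2)\<^sup>2
        \<longleftrightarrow> t\<^sup>2 = s * (1 - s) * (cmod (b - a))\<^sup>2" for s
  proof -
    have "a + of_real s * (b - a) - (a + b) / 2 = of_real (s - 1 / 2) * (b - a)"
      by (simp add: field_simps)
    hence "(cmod (a + of_real s * (b - a) - (a + b) / 2))\<^sup>2 = (s - 1 / 2)\<^sup>2 * (cmod (b - a))\<^sup>2"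
      by (simp only: norm_mult norm_of_real power_mult_distrib power2_abs)
    thus ?thesis by (simp add: power2_eq_square field_simps) (auto simp: algebra_simps)
  qed
  thus ?thesis by auto
qed

text \<open>The parameter \<open>x = 2 * r / D\<close> is the ratio \<open>s * D / t\<close> of
  horizontal distance from \<open>a\<close> to height at the intersection point.\<close>

lemma geodesic_Int_horosphere:
  assumes ab: "a \<noteq> b" and r: "r > 0"
  shows "geodesic (Fin a) (Fin b) \<inter> horosphere (Fin a) r
         = {geodesic_point a b (2 * r / cmod (b - a))}"
proof -
  define D where "D = cmod (b - a)"
  define x where "x = 2 * r / D"
  have D: "D > 0" using ab by (simp add: D_def)
  have x: "x > 0" using D r by (simp add: x_def)
  have r_eq: "2 * r = D * x" using D by (simp add: x_def)
  have nz: "1 + x\<^sup>2 \<noteq> 0" by (metis add_pos_nonneg less_irrefl zero_le_power2 zero_less_one)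
  have iff: "t\<^sup>2 = s * (1 - s) * D\<^sup>2 \<and> (\<bar>s\<bar> * D)\<^sup>2 + (t - r)\<^sup>2 = r\<^sup>2
        \<longleftrightarrow> s = x\<^sup>2 / (1 + x\<^sup>2) \<and> t = D * x / (1 + x\<^sup>2)" if t: "t > 0" for s t
  proof
    assume "t\<^sup>2 = s * (1 - s) * D\<^sup>2 \<and> (\<bar>s\<bar> * D)\<^sup>2 + (t - r)\<^sup>2 = r\<^sup>2"
    hence 1: "t\<^sup>2 = s * (1 - s) * D\<^sup>2" and "(\<bar>s\<bar> * D)\<^sup>2 + (t - r)\<^sup>2 = r\<^sup>2" by blast+
    from this(2) have "s\<^sup>2 * D\<^sup>2 + (t\<^sup>2 - 2 * t * r) = 0"
      by (simp add: power_mult_distrib power2_diff)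
    hence 2: "s\<^sup>2 * D\<^sup>2 + t\<^sup>2 = (2 * r) * t" by (simp add: algebra_simps)
    \<comment> \<open>Substituting the geodesic equation into the horosphere equation cancels the
      quadratic terms and leaves a linear relation of \<open>s\<close> and \<open>t\<close>.\<close>
    have "D * (s * D) = D * (x * t)"
      using 1 2 unfolding r_eq by (simp add: power2_eq_square algebra_simps)
    hence sD: "s * D = x * t" using D by simp
    have "t * (t * (1 + x\<^sup>2)) = t * (D * x)"
      using 2 unfolding r_eq power_mult_distrib[symmetric] sD
      by (simp add: power2_eq_square algebra_simps)
    hence "t * (1 + x\<^sup>2) = D * x" using t by simp
    hence t_eq: "t = D * x / (1 + x\<^sup>2)" using nz by (simp add: field_simps)
    have "s = x * t / D" using sD D by (simp add: field_simps)
    also have "\<dots> = x\<^sup>2 / (1 + x\<^sup>2)" unfolding t_eq using D by (simp add: power2_eq_square)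
    finally show "s = x\<^sup>2 / (1 + x\<^sup>2) \<and> t = D * x / (1 + x\<^sup>2)" using t_eq by blast
  next
    assume st: "s = x\<^sup>2 / (1 + x\<^sup>2) \<and> t = D * x / (1 + x\<^sup>2)"
    \<comment> \<open>Naming the reciprocal makes both equations polynomial modulo
      \<open>w * (1 + x^2) = 1\<close>.\<close>
    define w where "w = 1 / (1 + x\<^sup>2)"
    have w: "w * (1 + x\<^sup>2) = 1" using nz by (simp add: w_def)
    have s': "s = x\<^sup>2 * w" and t': "t = D * x * w" using st by (simp_all add: w_def)
    have "t\<^sup>2 = s * (1 - s) * D\<^sup>2" unfolding s' t' using w by algebra
    moreover have "s\<^sup>2 * D\<^sup>2 + t\<^sup>2 = (2 * r) * t" unfolding s' t' r_eq using w by algebra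
    moreover from this have "(\<bar>s\<bar> * D)\<^sup>2 + (t - r)\<^sup>2 = r\<^sup>2"
      by (simp add: power_mult_distrib power2_diff algebra_simps)
    ultimately show "t\<^sup>2 = s * (1 - s) * D\<^sup>2 \<and> (\<bar>s\<bar> * D)\<^sup>2 + (t - r)\<^sup>2 = r\<^sup>2"
      by blast
  qed
  have pos: "D * x / (1 + x\<^sup>2) > 0" using D x nz by (simp add: add_pos_nonneg)
  have "P \<in> geodesic (Fin a) (Fin b) \<inter> horosphere (Fin a) r \<longleftrightarrow> P = geodesic_point a b x" for P
  proof -
    obtain z t where P: "P = (z, t)" by (cases P)
    have "P \<in> geodesic (Fin a) (Fin b) \<inter> horosphere (Fin a) r \<longleftrightarrow> t > 0 \<and>
        (\<exists>s. z = a + of_real s * (b - a) \<and> t\<^sup>2 = s * (1 - s) * D\<^sup>2 \<and> (\<bar>s\<bar> * D)\<^sup>2 + (t - r)\<^sup>2 = r\<^sup>2)"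
      unfolding P Int_iff geodesic_Fin_iff[OF ab] D_def[symmetric]
      by (auto simp: norm_mult D_def)
    also have "\<dots> \<longleftrightarrow> t > 0 \<and> (\<exists>s. z = a + of_real s * (b - a) \<and>
        s = x\<^sup>2 / (1 + x\<^sup>2) \<and> t = D * x / (1 + x\<^sup>2))"
      by (intro conj_cong refl ex_cong1 iff)
    also have "\<dots> \<longleftrightarrow> z = a + of_real (x\<^sup>2 / (1 + x\<^sup>2)) * (b - a) \<and> t = D * x / (1 + x\<^sup>2)"
      using pos by auto
    finally show ?thesis by (simp add: P geodesic_point_def D_def)
  qed
  thus ?thesis by (intro set_eqI) (simp only: x_def D_def singleton_iff)
qed

lemma geodesic_commute: "geodesic (Fin a) (Fin b) = geodesic (Fin b) (Fin a)"
proof (cases "a = b")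
  case False
  have "(z, t) \<in> geodesic (Fin b) (Fin a)" if zt: "(z, t) \<in> geodesic (Fin a) (Fin b)" and ab: "a \<noteq> b" for a b z t
  proof -
    obtain s where s: "t > 0" "z = a + of_real s * (b - a)" "t\<^sup>2 = s * (1 - s) * (cmod (b - a))\<^sup>2"
      using zt unfolding geodesic_Fin_iff[OF ab] by blast
    have "z = b + of_real (1 - s) * (a - b)" by (simp add: s(2) algebra_simps)
    moreover have "t\<^sup>2 = (1 - s) * (1 - (1 - s)) * (cmod (a - b))\<^sup>2"
      by (simp add: s(3) norm_minus_commute)
    ultimately show ?thesis using s(1) unfolding geodesic_Fin_iff[OF ab[symmetric]] by blast
  qed
  thus ?thesis using False by (metis subrelI subset_antisym)
qed simp

text \<open>Reversing the geodesic inverts the parameter; this lets the intersection at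
  \<open>b\<close> be expressed by the parameter starting at \<open>a\<close>.\<close>

lemma geodesic_point_commute:
  assumes "x > 0"
  shows "geodesic_point b a (1 / x) = geodesic_point a b x"
proof -
  have nz: "1 + x\<^sup>2 \<noteq> 0" by (metis add_pos_nonneg less_irrefl zero_le_power2 zero_less_one)
  have z: "(1 / x)\<^sup>2 / (1 + (1 / x)\<^sup>2) = 1 - x\<^sup>2 / (1 + x\<^sup>2)"
    using assms nz by (simp add: field_simps power2_eq_square)
  have t: "cmod (a - b) * (1 / x) / (1 + (1 / x)\<^sup>2) = cmod (b - a) * x / (1 + x\<^sup>2)"
    using assms nz by (simp add: norm_minus_commute field_simps power2_eq_square)
  have "b + (1 - w) * (a - b) = a + w * (b - a)" for w by (simp add: algebra_simps)
  thus ?thesis by (simp only: geodesic_point_def z t of_real_diff of_real_1)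
qed

lemma lambda_length_Fin_Fin:
  assumes ab: "a \<noteq> b" and r: "r > 0" and s: "s > 0"
  shows "lambda_length (Fin a) (horosphere (Fin a) r) (Fin b) (horosphere (Fin b) s)
         = cmod (b - a) / (2 * sqrt (r * s))"
proof -
  define D where "D = cmod (b - a)"
  have D: "D > 0" using ab by (simp add: D_def)
  \<comment> \<open>\<open>y\<close> is the reciprocal of \<open>2 * s / D\<close>, the parameter of
    the second point as seen from \<open>b\<close>.\<close>
  define x y where "x = 2 * r / D" and "y = D / (2 * s)"
  have xy: "x > 0" "y > 0" using r s D by (auto simp: x_def y_def)
  have "lambda_length (Fin a) (horosphere (Fin a) r) (Fin b) (horosphere (Fin b) s) = sqrt (y / x)"
  proof (rule lambda_length_eq_sqrt_ratio)
    show "geodesic (Fin a) (Fin b) \<inter> horosphere (Fin a) r = {geodesic_point a b x}"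
      using geodesic_Int_horosphere[OF ab r] by (simp only: x_def D_def)
    show "geodesic (Fin a) (Fin b) \<inter> horosphere (Fin b) s = {geodesic_point a b y}"
      using geodesic_Int_horosphere[OF ab[symmetric] s] geodesic_point_commute[OF xy(2), of b a]
      by (simp only: geodesic_commute[of b a]) (simp add: y_def D_def norm_minus_commute)
    show "hyp_dist (geodesic_point a b x) (geodesic_point a b y)
          = arcosh (1 + (x - y)\<^sup>2 / (2 * x * y))"
      using hyp_dist_geodesic_point ab xy .
    have "x \<le> y \<longleftrightarrow> 4 * r * s \<le> D\<^sup>2"
      using D s by (simp add: x_def y_def field_simps power2_eq_square)
    thus "horoball_of (Fin a) (horosphere (Fin a) r) \<inter> horoball_of (Fin b) (horosphere (Fin b) s)
          = {} \<longleftrightarrow> x \<le> y"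
      using horoballs_disjoint_iff[OF r s, of a b]
      by (simp only: horoball_of_horosphere[OF r] horoball_of_horosphere[OF s] D_def)
  qed (use xy in auto)
  also have "y / x = (D / (2 * sqrt (r * s)))\<^sup>2"
    using D r s by (simp add: x_def y_def power_divide power_mult_distrib) (simp add: power2_eq_square)
  also have "sqrt \<dots> = D / (2 * sqrt (r * s))" using D r s by (simp add: real_sqrt_abs)
  finally show ?thesis by (simp add: D_def)
qed

lemma lambda_length_vec_horosphere:
  assumes "eis_unimodular p1 q1" "eis_unimodular p2 q2" "fraction p1 q1 \<noteq> fraction p2 q2"
  shows "lambda_length (fraction p1 q1) (vec_horosphere p1 q1) (fraction p2 q2) (vec_horosphere p2 q2)
         = cmod (p1 * q2 - p2 * q1)"
proof -
  \<comment> \<open>At infinity the Bezout identity makes \<open>p\<close> a unit, so the horosphere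
    has height 1 and the determinant has the modulus of the other denominator.\<close>
  have unit: "cmod p = 1" if "eis_unimodular p 0" for p
    using that eis_unit_cmod by (auto simp: eis_unimodular_def mult.commute)
  have Fin_Infty: "lambda_length (Fin (p / q)) (vec_horosphere p q) Infty (horosphere Infty 1) = cmod q"
    if "q \<noteq> 0" for p q
    unfolding vec_horosphere_Fin[OF that] using that by (subst lambda_length_Fin_Infty) auto
  consider "q1 = 0" "q2 = 0" | "q1 = 0" "q2 \<noteq> 0" | "q1 \<noteq> 0" "q2 = 0" | "q1 \<noteq> 0" "q2 \<noteq> 0"
    by blast
  thus ?thesis
  proof cases
    case 1
    thus ?thesis using assms(3) by (simp add: fraction_def)
  next
    case 2
    thus ?thesis using unit assms(1) Fin_Infty
      by (simp add: fraction_def vec_horosphere_Infty lambda_length_Infty_Fin norm_mult del: horosphere.simps)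
  next
    case 3
    thus ?thesis using unit assms(2) Fin_Infty
      by (simp add: fraction_def vec_horosphere_Infty norm_mult del: horosphere.simps)
  next
    case 4
    define a b where "a = p1 / q1" and "b = p2 / q2"
    have "a \<noteq> b" using assms(3) 4 by (simp add: fraction_def a_def b_def)
    hence "lambda_length (Fin a) (vec_horosphere p1 q1) (Fin b) (vec_horosphere p2 q2)
        = cmod (b - a) / (2 * sqrt (1 / (2 * (cmod q1)\<^sup>2) * (1 / (2 * (cmod q2)\<^sup>2))))"
      using 4 lambda_length_Fin_Fin[of a b "1 / (2 * (cmod q1)\<^sup>2)" "1 / (2 * (cmod q2)\<^sup>2)"]
      by (simp add: vec_horosphere_Fin a_def b_def del: horosphere.simps)
    also have "1 / (2 * (cmod q1)\<^sup>2) * (1 / (2 * (cmod q2)\<^sup>2)) = (1 / (2 * cmod q1 * cmod q2))\<^sup>2"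
      by (simp add: power_divide power_mult_distrib)
    also have "sqrt \<dots> = 1 / (2 * cmod q1 * cmod q2)" by (simp add: real_sqrt_abs)
    also have "cmod (b - a) / (2 * (1 / (2 * cmod q1 * cmod q2))) = cmod ((a - b) * (q1 * q2))"
      using 4 by (simp add: norm_mult norm_minus_commute[of b])
    also have "(a - b) * (q1 * q2) = p1 * q2 - p2 * q1"
      using 4 by (simp add: a_def b_def field_simps)
    finally show ?thesis using 4 by (simp add: fraction_def a_def b_def)
  qed
qed

theorem theorem4p12:
  fixes X Y :: ideal_point and p1 q1 p2 q2 :: complex
  assumes "X \<in> eis_field_ext" and "Y \<in> eis_field_ext" and "X \<noteq> Y"
    and "irreducible_fraction p1 q1" and "X = fraction p1 q1"
    and "irreducible_fraction p2 q2" and "Y = fraction p2 q2"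
  shows "lambda_length X (std_horosphere X) Y (std_horosphere Y)
           = det_length (p1, q1) (p2, q2)"
proof -
  have "eis_unimodular p1 q1" "eis_unimodular p2 q2"
    using assms irreducible_fraction_unimodular by blast+
  thus ?thesis
    using assms lambda_length_vec_horosphere[of p1 q1 p2 q2]
    by (simp add: std_horosphere_fraction det_length_def)
qed

end
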